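(* Let $H$ be a real Hilbert space, let $\mathcal{D}\subset H$ be an $M$-coherent dictionary, let $f\in H$, and let $(f_n)_{n\ge 0}$ be the residuals and $(G_n^{OGA}(f,\mathcal{D}))_{n\ge 0}$ the approximants of any realization of the Orthogonal Greedy Algorithm applied to $f$ with respect to $\mathcal{D}$. Then for all integers $m$ with $$1\le m\le \frac{1}{20M}$$ we have $$\|f-G^{OGA}_{2m}(f,\mathcal{D})\|=\|f_{2m}\|\le 3\,\sigma_m(f).$$
   Context: A set $\mathcal{D}\subset H$ is a dictionary if every $\phi\in\mathcal{D}$ has $\|\phi\|=1$ and the closed linear span of $\mathcal{D}$ is $H$. Its coherence is $M:=\sup_{\phi,\psi\in\mathcal{D},\,\phi\ne\psi}|\langle\phi,\psi\rangle|$; a dictionary with coherence $M$ is called $M$-coherent. Orthogonal Greedy Algorithm (OGA): set $f_0:=f$, $G_0^{OGA}(f,\mathcal{D}):=0$. For each $m\ge 0$ inductively find $g_{m+1}\in\mathcal{D}$ with $|\langle f_m,g_{m+1}\rangle|=\sup_{g\in\mathcal{D}}|\langle f_m,g\rangle|$ (it is understood that the suprema are attained), and define $G_{m+1}^{OGA}(f,\mathcal{D})$ to be the orthogonal projection of $f$ onto $\operatorname{span}(g_1,\ldots,g_{m+1})$ and $f_{m+1}:=f-G_{m+1}^{OGA}(f,\mathcal{D})$. Best $m$-term approximation: $\sigma_m(f):=\sigma_m(f,\mathcal{D}):=\inf\{\|f-\sum_{i=1}^m c_i\phi_i\| : c_i\in\mathbb{R},\ \phi_i\in\mathcal{D},\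 1\le i\le m\}$. *)

theory Defs
  imports "HOL-Analysis.Analysis"
begin

definition dictionary :: "'a::real_inner set \<Rightarrow> bool" where
  "dictionary D \<longleftrightarrow> (\<forall>\<phi>\<in>D. norm \<phi> = 1) \<and> closure (span D) = UNIV"

text \<open>The supremum is taken in the nonnegative reals: inserting \<open>0\<close> changes nothing unless
  \<open>D\<close> has at most one element, in which case the coherence is \<open>0\<close> rather than the
  unspecified real \<open>Sup {}\<close>.\<close>

definition coherence :: "'a::real_inner set \<Rightarrow> real" where
  "coherence D = Sup (insert 0 {\<bar>\<phi> \<bullet> \<psi>\<bar> | \<phi> \<psi>. \<phi> \<in> D \<and> \<psi> \<in> D \<and> \<phi> \<noteq> \<psi>})"

definition coherent_dictionary :: "real \<Rightarrow> 'a::real_inner set \<Rightarrow> bool" where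
  "coherent_dictionary M D \<longleftrightarrow> dictionary D \<and> coherence D = M"

definition is_orthogonal_projection :: "'a::real_inner set \<Rightarrow> 'a \<Rightarrow> 'a \<Rightarrow> bool" where
  "is_orthogonal_projection S x p \<longleftrightarrow> p \<in> S \<and> (\<forall>y\<in>S. orthogonal (x - p) y)"

text \<open>A run of the algorithm on \<open>f\<close>: selected elements \<open>g 1, g 2, \<dots>\<close> (the value \<open>g 0\<close> is
  unused), approximants \<open>G n\<close> and residuals \<open>r n\<close>. The maximizer need not be unique,
  so this is a relation rather than a function.\<close>

definition OGA_realization ::
  "'a::real_inner set \<Rightarrow> 'a \<Rightarrow> (nat \<Rightarrow> 'a) \<Rightarrow> (nat \<Rightarrow> 'a) \<Rightarrow> (nat \<Rightarrow> 'a) \<Rightarrow> bool" where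
  "OGA_realization D f g G r \<longleftrightarrow>
     r 0 = f \<and> G 0 = 0 \<and>
     (\<forall>m. g (Suc m) \<in> D \<and>
          \<bar>r m \<bullet> g (Suc m)\<bar> = (SUP h\<in>D. \<bar>r m \<bullet> h\<bar>) \<and>
          is_orthogonal_projection (span (g ` {1..Suc m})) f (G (Suc m)) \<and>
          r (Suc m) = f - G (Suc m))"

definition best_approx_error :: "nat \<Rightarrow> 'a::real_inner set \<Rightarrow> 'a \<Rightarrow> real" where
  "best_approx_error m D f =
     Inf {norm (f - (\<Sum>i = 1..m. c i *\<^sub>R \<phi> i)) | (c :: nat \<Rightarrow> real) \<phi>. \<forall>i\<in>{1..m}. \<phi> i \<in> D}"

end

theory Submission imports Defs begin

text \<open>
  Fix any \<open>m\<close> atoms \<open>T\<close>; the claim is that \<open>norm (r (2 * m))\<close> is at most a constant times the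
  distance from \<open>f\<close> to \<open>span T\<close>. Let \<open>A\<^sub>n\<close> be the first \<open>n\<close> selected atoms and split the residual
  as \<open>r n = h\<^sub>n + u\<^sub>n\<close>, where \<open>h\<^sub>n\<close> is the residual of \<open>f\<close> for the larger space
  \<open>span (A\<^sub>n \<union> T)\<close>. Thus \<open>norm h\<^sub>0\<close> is the distance from \<open>f\<close> to \<open>span T\<close>, and \<open>norm h\<^sub>n\<close> decreases
  with \<open>n\<close>.

  The component \<open>u\<^sub>n\<close> lies in the span of at most \<open>3 * m\<close> atoms. Their Gram matrix is diagonally
  dominant, because \<open>3 * m * M \<le> 3 / 20\<close>, so \<open>u\<^sub>n\<close> is controlled by its inner products with these
  atoms (\<open>span_coeffs_bound\<close>). Those with atoms of \<open>A\<^sub>n\<close> vanish, and those with atoms of \<open>T\<close> are at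
  most the greedy maximum \<open>d\<^sub>n = \<bar>r n \<bullet> g (n + 1)\<bar>\<close>. Two consequences follow
  (\<open>residual_energy_bound\<close> and \<open>fresh_atom_correlation\<close>): the square of \<open>norm u\<^sub>n\<close> is at most
  \<open>20/17 * m * d\<^sub>n\<^sup>2\<close>, and an atom outside \<open>A\<^sub>n \<union> T\<close> is almost orthogonal to \<open>u\<^sub>n\<close>.

  Call a step wrong if it does not select a new atom of \<open>T\<close>. A wrong step has to draw its
  correlation \<open>d\<^sub>n\<close> almost entirely from \<open>h\<^sub>n\<close>, so it lowers the square of \<open>norm h\<^sub>n\<close> by at least
  \<open>(16/17 * d\<^sub>n)\<^sup>2\<close>. At most \<open>m\<close> of the \<open>2 * m\<close> steps select a new atom of \<open>T\<close>, so at least \<open>m\<close>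
  steps are wrong; since the sum of the decreases is at most the square of \<open>norm h\<^sub>0\<close>, the average
  of \<open>m * d\<^sub>n\<^sup>2\<close> over the wrong steps is at most \<open>(17/16)\<^sup>2\<close> times the square of \<open>norm h\<^sub>0\<close>. The
  residuals \<open>r n\<close> decrease in norm, so averaging the bound on \<open>r n\<close> over the wrong steps bounds
  \<open>r (2 * m)\<close>. The resulting constant is the square root of \<open>1 + 20/17 * (17/16)\<^sup>2\<close>, which is
  below \<open>3\<close>.
\<close>

section \<open>Orthogonal projections onto finite-dimensional subspaces\<close>

lemma orthogonal_projection_span_exists:
  fixes B :: "'a::real_inner set"
  assumes "finite B"
  shows "\<exists>p. is_orthogonal_projection (span B) x p"
proof -
  obtain C where C: "finite C" "span C = span B" "pairwise orthogonal C"
    using basis_orthogonal[OF assms] by blast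
  define p where "p = (\<Sum>c\<in>C. (x \<bullet> c / (c \<bullet> c)) *\<^sub>R c)"
  have "p \<in> span C"
    unfolding p_def by (intro span_sum span_scale span_base)
  moreover have "orthogonal (x - p) y" if "y \<in> span C" for y
  proof (rule orthogonal_to_span[OF that])
    fix c assume c: "c \<in> C"
    have "p \<bullet> c = (\<Sum>b\<in>C. if b = c then x \<bullet> c else 0)"
      unfolding p_def inner_sum_left
      using C(3) c by (intro sum.cong) (auto simp: pairwise_def orthogonal_def)
    also have "\<dots> = x \<bullet> c"
      using C(1) c by simp
    finally show "orthogonal (x - p) c"
      by (simp add: orthogonal_def inner_diff_left)
  qed
  ultimately show ?thesis
    using C(2) unfolding is_orthogonal_projection_def by auto
qed

lemma orthogonal_projection_nearest:
  assumes "is_orthogonal_projection (span S) x p" and "y \<in> span S"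
  shows "norm (x - p) \<le> norm (x - y)"
proof -
  have "p - y \<in> span S"
    using assms by (auto simp: is_orthogonal_projection_def intro: span_diff)
  then have "orthogonal (x - p) (p - y)"
    using assms(1) by (auto simp: is_orthogonal_projection_def)
  from norm_add_Pythagorean[OF this]
  have "(norm (x - p))\<^sup>2 \<le> (norm (x - y))\<^sup>2"
    by simp
  then show ?thesis
    using norm_ge_zero power2_le_imp_le by blast
qed

lemma norm_residual_antimono:
  assumes "is_orthogonal_projection (span S) x p" and "is_orthogonal_projection (span S') x p'"
    and "S \<subseteq> S'"
  shows "norm (x - p') \<le> norm (x - p)"
proof (rule orthogonal_projection_nearest[OF assms(2)])
  show "p \<in> span S'"
    using assms(1) span_mono[OF assms(3)] by (auto simp: is_orthogonal_projection_def)
qed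

text \<open>A single line-search step in direction \<open>g\<close> already achieves this decrease, and projecting
  onto the enlarged space cannot do worse.\<close>

lemma projection_insert_decrease:
  assumes "is_orthogonal_projection (span S) x p" and "is_orthogonal_projection (span S') x p'"
    and "S \<subseteq> S'" and "g \<in> S'" and "norm g = 1"
  shows "(norm (x - p'))\<^sup>2 \<le> (norm (x - p))\<^sup>2 - ((x - p) \<bullet> g)\<^sup>2"
proof -
  define c where "c = (x - p) \<bullet> g"
  have "p \<in> span S'"
    using assms(1) span_mono[OF assms(3)] by (auto simp: is_orthogonal_projection_def)
  then have "p + c *\<^sub>R g \<in> span S'"
    using assms(4) by (intro span_add span_scale) (auto intro: span_base)
  from orthogonal_projection_nearest[OF assms(2) this]
  have "norm (x - p') \<le> norm ((x - p) - c *\<^sub>R g)"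
    by (simp add: algebra_simps)
  then have "(norm (x - p'))\<^sup>2 \<le> (norm ((x - p) - c *\<^sub>R g))\<^sup>2"
    by (rule power_mono) simp
  also have "\<dots> = (norm (x - p))\<^sup>2 + (norm (c *\<^sub>R g))\<^sup>2 - 2 * (c * c)"
    using dot_norm_neg[of "x - p" "c *\<^sub>R g"] by (simp add: c_def)
  also have "\<dots> = (norm (x - p))\<^sup>2 - c\<^sup>2"
    using assms(5) by (simp add: power2_eq_square)
  finally show ?thesis
    by (simp add: c_def)
qed

section \<open>Stability of spans of few incoherent atoms\<close>

text \<open>Taking the inner product of \<open>u\<close> with the atom \<open>s\<close> isolates the coefficient of \<open>s\<close> up to an
  error of \<open>\<mu>\<close> times the sum of all coefficients in absolute value. Summing over \<open>s\<close> gives the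
  diagonal dominance estimate; it involves only the correlations with \<open>R\<close>, as the others vanish.\<close>

lemma span_coeffs_bound:
  fixes S R :: "'a::real_inner set" and u :: 'a and \<mu> d :: real
  assumes "finite S" and "R \<subseteq> S" and "0 \<le> \<mu>"
    and unit: "\<And>s. s \<in> S \<Longrightarrow> norm s = 1"
    and coh: "\<And>s t. s \<in> S \<Longrightarrow> t \<in> S \<Longrightarrow> s \<noteq> t \<Longrightarrow> \<bar>s \<bullet> t\<bar> \<le> \<mu>"
    and "u \<in> span S"
    and perp: "\<And>s. s \<in> S - R \<Longrightarrow> u \<bullet> s = 0"
    and corr: "\<And>s. s \<in> R \<Longrightarrow> \<bar>u \<bullet> s\<bar> \<le> d"
  obtains a where "u = (\<Sum>s\<in>S. a s *\<^sub>R s)"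
    and "(1 - card S * \<mu>) * (\<Sum>s\<in>S. \<bar>a s\<bar>) \<le> card R * d"
proof -
  obtain a where a: "u = (\<Sum>s\<in>S. a s *\<^sub>R s)"
    using \<open>u \<in> span S\<close> span_finite[OF \<open>finite S\<close>] by auto
  define L where "L = (\<Sum>s\<in>S. \<bar>a s\<bar>)"
  have coeff: "\<bar>a s\<bar> \<le> \<bar>u \<bullet> s\<bar> + \<mu> * L" if s: "s \<in> S" for s
  proof -
    have "u \<bullet> s = a s * (s \<bullet> s) + (\<Sum>t\<in>S - {s}. a t * (t \<bullet> s))"
      unfolding a inner_sum_left using s \<open>finite S\<close> by (simp add: sum.remove)
    then have "a s = u \<bullet> s - (\<Sum>t\<in>S - {s}. a t * (t \<bullet> s))"
      using unit[OF s] by (simp add: dot_square_norm)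
    then have "\<bar>a s\<bar> \<le> \<bar>u \<bullet> s\<bar> + \<bar>\<Sum>t\<in>S - {s}. a t * (t \<bullet> s)\<bar>"
      by linarith
    moreover have "\<bar>\<Sum>t\<in>S - {s}. a t * (t \<bullet> s)\<bar> \<le> (\<Sum>t\<in>S - {s}. \<bar>a t\<bar> * \<mu>)"
      using coh s by (intro order_trans[OF sum_abs] sum_mono) (auto simp: abs_mult intro!: mult_left_mono)
    moreover have "(\<Sum>t\<in>S - {s}. \<bar>a t\<bar> * \<mu>) \<le> (\<Sum>t\<in>S. \<bar>a t\<bar> * \<mu>)"
      using \<open>finite S\<close> \<open>0 \<le> \<mu>\<close> by (intro sum_mono2) auto
    moreover have "(\<Sum>t\<in>S. \<bar>a t\<bar> * \<mu>) = \<mu> * L"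
      by (simp add: L_def sum_distrib_right[symmetric])
    ultimately show ?thesis
      by linarith
  qed
  have "L \<le> (\<Sum>s\<in>S. \<bar>u \<bullet> s\<bar> + \<mu> * L)"
    unfolding L_def by (rule sum_mono) (use coeff L_def in auto)
  also have "\<dots> = (\<Sum>s\<in>S. \<bar>u \<bullet> s\<bar>) + card S * \<mu> * L"
    by (simp add: sum.distrib)
  also have "(\<Sum>s\<in>S. \<bar>u \<bullet> s\<bar>) = (\<Sum>s\<in>R. \<bar>u \<bullet> s\<bar>)"
    using assms(1,2) perp by (intro sum.mono_neutral_right) auto
  also have "\<dots> \<le> card R * d"
    using sum_bounded_above[of R "\<lambda>s. \<bar>u \<bullet> s\<bar>" d] corr by auto
  finally show thesis
    using that[OF a] by (simp add: L_def algebra_simps)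
qed

text \<open>In the following lemmas \<open>A\<close> is the set of atoms selected so far, \<open>r\<close> is the current residual,
  and \<open>T\<close> is a competing set of atoms. The difference \<open>r - (f - p)\<close> is the component of \<open>r\<close> in
  \<open>span (A \<union> T)\<close>; it has the same correlations with the atoms of \<open>A \<union> T\<close> as \<open>r\<close>. The constant \<open>20/17\<close>
  is the inverse of \<open>1 - 3/20\<close>.\<close>

lemma competing_component_coeffs:
  fixes A T :: "'a::real_inner set" and \<mu> d :: real
  assumes fin: "finite A" "finite T" and "0 \<le> \<mu>"
    and unit: "\<And>s. s \<in> A \<union> T \<Longrightarrow> norm s = 1"
    and coh: "\<And>s t. s \<in> A \<union> T \<Longrightarrow> t \<in> A \<union> T \<Longrightarrow> s \<noteq> t \<Longrightarrow> \<bar>s \<bullet> t\<bar> \<le> \<mu>"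
    and q: "is_orthogonal_projection (span A) f q" and r: "r = f - q"
    and p: "is_orthogonal_projection (span (A \<union> T)) f p"
    and max: "\<And>t. t \<in> T \<Longrightarrow> \<bar>r \<bullet> t\<bar> \<le> d"
    and small: "card (A \<union> T) * \<mu> \<le> 3 / 20"
  obtains a where "r - (f - p) = (\<Sum>s\<in>A \<union> T. a s *\<^sub>R s)"
    and "(\<Sum>s\<in>A \<union> T. \<bar>a s\<bar>) \<le> 20 / 17 * (card T * d)"
    and "\<And>s. s \<in> A \<union> T \<Longrightarrow> (r - (f - p)) \<bullet> s = r \<bullet> s"
    and "\<And>s. s \<in> A \<Longrightarrow> r \<bullet> s = 0"
proof -
  define u where "u = r - (f - p)"
  have q_span: "q \<in> span (A \<union> T)"
    using q span_mono[of A "A \<union> T"] by (auto simp: is_orthogonal_projection_def)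
  then have u_span: "u \<in> span (A \<union> T)"
    using p span_diff[of p "A \<union> T" q] by (simp add: u_def r is_orthogonal_projection_def)
  have same: "u \<bullet> s = r \<bullet> s" if "s \<in> A \<union> T" for s
    using p span_base[OF that]
    by (simp add: u_def inner_diff_left is_orthogonal_projection_def orthogonal_def)
  have perp: "r \<bullet> s = 0" if "s \<in> A" for s
    using q span_base[OF that] by (simp add: r is_orthogonal_projection_def orthogonal_def)
  obtain a where a: "u = (\<Sum>s\<in>A \<union> T. a s *\<^sub>R s)"
    and le: "(1 - card (A \<union> T) * \<mu>) * (\<Sum>s\<in>A \<union> T. \<bar>a s\<bar>) \<le> card T * d"
  proof (rule span_coeffs_bound[of "A \<union> T" T \<mu> u d])
    show "\<bar>s \<bullet> t\<bar> \<le> \<mu>" if "s \<in> A \<union> T" "t \<in> A \<union> T" "s \<noteq> t" for s t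
      by (rule coh[OF that])
  qed (use fin unit u_span same perp max \<open>0 \<le> \<mu>\<close> in auto)
  have "(17 / 20) * (\<Sum>s\<in>A \<union> T. \<bar>a s\<bar>) \<le> (1 - card (A \<union> T) * \<mu>) * (\<Sum>s\<in>A \<union> T. \<bar>a s\<bar>)"
    using small by (intro mult_right_mono sum_nonneg) auto
  with le have "(\<Sum>s\<in>A \<union> T. \<bar>a s\<bar>) \<le> 20 / 17 * (card T * d)"
    by linarith
  with a same perp that show thesis
    unfolding u_def by blast
qed

lemma residual_energy_bound:
  fixes A T :: "'a::real_inner set" and \<mu> d :: real
  assumes fin: "finite A" "finite T" and "0 \<le> \<mu>"
    and unit: "\<And>s. s \<in> A \<union> T \<Longrightarrow> norm s = 1"
    and coh: "\<And>s t. s \<in> A \<union> T \<Longrightarrow> t \<in> A \<union> T \<Longrightarrow> s \<noteq> t \<Longrightarrow> \<bar>s \<bullet> t\<bar> \<le> \<mu>"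
    and q: "is_orthogonal_projection (span A) f q" and r: "r = f - q"
    and p: "is_orthogonal_projection (span (A \<union> T)) f p"
    and max: "\<And>t. t \<in> T \<Longrightarrow> \<bar>r \<bullet> t\<bar> \<le> d" and "0 \<le> d"
    and small: "card (A \<union> T) * \<mu> \<le> 3 / 20"
  shows "(norm r)\<^sup>2 \<le> (norm (f - p))\<^sup>2 + 20 / 17 * card T * d\<^sup>2"
proof -
  define u where "u = r - (f - p)"
  obtain a where a: "u = (\<Sum>s\<in>A \<union> T. a s *\<^sub>R s)"
    and L: "(\<Sum>s\<in>A \<union> T. \<bar>a s\<bar>) \<le> 20 / 17 * (card T * d)"
    and same: "\<And>s. s \<in> A \<union> T \<Longrightarrow> u \<bullet> s = r \<bullet> s"
    and perp: "\<And>s. s \<in> A \<Longrightarrow> r \<bullet> s = 0"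
    using competing_component_coeffs[OF fin \<open>0 \<le> \<mu>\<close> unit coh q r p max small]
    unfolding u_def by blast
  have corr: "\<bar>u \<bullet> s\<bar> \<le> d" if "s \<in> A \<union> T" for s
    using that same[OF that] perp max \<open>0 \<le> d\<close> by auto
  have "u \<in> span (A \<union> T)"
    unfolding a by (intro span_sum span_scale span_base)
  then have "orthogonal (f - p) u"
    using p by (simp add: is_orthogonal_projection_def)
  from norm_add_Pythagorean[OF this] have "(norm r)\<^sup>2 = (norm (f - p))\<^sup>2 + (norm u)\<^sup>2"
    by (simp add: u_def)
  moreover have "(norm u)\<^sup>2 \<le> 20 / 17 * card T * d\<^sup>2"
  proof -
    have "(norm u)\<^sup>2 = u \<bullet> (\<Sum>s\<in>A \<union> T. a s *\<^sub>R s)"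
      unfolding a[symmetric] by (rule power2_norm_eq_inner)
    also have "\<dots> = (\<Sum>s\<in>A \<union> T. a s * (u \<bullet> s))"
      by (simp add: inner_sum_right)
    also have "\<dots> \<le> (\<Sum>s\<in>A \<union> T. \<bar>a s\<bar> * d)"
    proof (rule sum_mono)
      fix s assume "s \<in> A \<union> T"
      then have "\<bar>a s\<bar> * \<bar>u \<bullet> s\<bar> \<le> \<bar>a s\<bar> * d"
        using corr by (intro mult_left_mono) auto
      then show "a s * (u \<bullet> s) \<le> \<bar>a s\<bar> * d"
        using abs_ge_self[of "a s * (u \<bullet> s)"] by (simp add: abs_mult)
    qed
    also have "\<dots> = (\<Sum>s\<in>A \<union> T. \<bar>a s\<bar>) * d"
      by (simp add: sum_distrib_right)
    also have "\<dots> \<le> 20 / 17 * (card T * d) * d"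
      using L \<open>0 \<le> d\<close> by (rule mult_right_mono)
    finally show ?thesis
      by (simp add: power2_eq_square)
  qed
  ultimately show ?thesis
    by linarith
qed

text \<open>The atoms of \<open>A \<union> T\<close> can only pass on a fraction \<open>20/17 * 1/20 = 1/17\<close> of the greedy
  correlation to an atom outside, so the rest must come from the part of \<open>f\<close> that is orthogonal to
  \<open>span (A \<union> T)\<close>.\<close>

lemma fresh_atom_correlation:
  fixes A T :: "'a::real_inner set" and \<mu> :: real
  assumes fin: "finite A" "finite T" and "0 \<le> \<mu>"
    and unit: "\<And>s. s \<in> A \<union> T \<Longrightarrow> norm s = 1"
    and coh: "\<And>s t. s \<in> A \<union> T \<Longrightarrow> t \<in> A \<union> T \<Longrightarrow> s \<noteq> t \<Longrightarrow> \<bar>s \<bullet> t\<bar> \<le> \<mu>"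
    and q: "is_orthogonal_projection (span A) f q" and r: "r = f - q"
    and p: "is_orthogonal_projection (span (A \<union> T)) f p"
    and max: "\<And>t. t \<in> T \<Longrightarrow> \<bar>r \<bullet> t\<bar> \<le> \<bar>r \<bullet> g\<bar>"
    and small: "card (A \<union> T) * \<mu> \<le> 3 / 20" "card T * \<mu> \<le> 1 / 20"
    and g: "\<And>s. s \<in> A \<union> T \<Longrightarrow> \<bar>s \<bullet> g\<bar> \<le> \<mu>"
  shows "16 / 17 * \<bar>r \<bullet> g\<bar> \<le> \<bar>(f - p) \<bullet> g\<bar>"
proof -
  define u where "u = r - (f - p)"
  obtain a where a: "u = (\<Sum>s\<in>A \<union> T. a s *\<^sub>R s)"
    and L: "(\<Sum>s\<in>A \<union> T. \<bar>a s\<bar>) \<le> 20 / 17 * (card T * \<bar>r \<bullet> g\<bar>)"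
  proof (rule competing_component_coeffs[OF fin \<open>0 \<le> \<mu>\<close> unit coh q r p max small(1)])
    fix a assume "r - (f - p) = (\<Sum>s\<in>A \<union> T. a s *\<^sub>R s)"
      and "(\<Sum>s\<in>A \<union> T. \<bar>a s\<bar>) \<le> 20 / 17 * (card T * \<bar>r \<bullet> g\<bar>)"
    then show thesis
      using that[of a] by (simp add: u_def)
  qed
  have "\<bar>u \<bullet> g\<bar> \<le> (\<Sum>s\<in>A \<union> T. \<bar>a s\<bar> * \<mu>)"
    unfolding a inner_sum_left using g
    by (intro order_trans[OF sum_abs] sum_mono) (auto simp: abs_mult intro!: mult_left_mono)
  also have "\<dots> = (\<Sum>s\<in>A \<union> T. \<bar>a s\<bar>) * \<mu>"
    by (simp add: sum_distrib_right)
  also have "\<dots> \<le> 20 / 17 * (card T * \<bar>r \<bullet> g\<bar>) * \<mu>"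
    using L \<open>0 \<le> \<mu>\<close> by (rule mult_right_mono)
  also have "\<dots> = 20 / 17 * \<bar>r \<bullet> g\<bar> * (card T * \<mu>)"
    by simp
  also have "\<dots> \<le> 20 / 17 * \<bar>r \<bullet> g\<bar> * (1 / 20)"
    using small(2) by (intro mult_left_mono) auto
  finally have "\<bar>u \<bullet> g\<bar> \<le> \<bar>r \<bullet> g\<bar> / 17"
    by simp
  moreover have "r \<bullet> g = u \<bullet> g + (f - p) \<bullet> g"
    by (simp add: u_def inner_diff_left)
  ultimately show ?thesis
    by linarith
qed

section \<open>Dictionaries and runs of the algorithm\<close>

lemma dictionary_unit:
  "dictionary D \<Longrightarrow> \<phi> \<in> D \<Longrightarrow> norm \<phi> = 1"
  by (simp add: dictionary_def)

lemma coherence_bounds: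
  fixes D :: "'a::real_inner set"
  assumes "dictionary D"
  shows coherence_nonneg: "0 \<le> coherence D"
    and abs_inner_le_coherence: "\<phi> \<in> D \<Longrightarrow> \<psi> \<in> D \<Longrightarrow> \<phi> \<noteq> \<psi> \<Longrightarrow> \<bar>\<phi> \<bullet> \<psi>\<bar> \<le> coherence D"
proof -
  let ?X = "insert 0 {\<bar>\<phi> \<bullet> \<psi>\<bar> | \<phi> \<psi>. \<phi> \<in> D \<and> \<psi> \<in> D \<and> \<phi> \<noteq> \<psi>}"
  have "bdd_above ?X"
  proof (rule bdd_aboveI)
    fix x assume "x \<in> ?X"
    moreover have "\<bar>\<phi> \<bullet> \<psi>\<bar> \<le> 1" if "\<phi> \<in> D" "\<psi> \<in> D" for \<phi> \<psi>
      using Cauchy_Schwarz_ineq2[of \<phi> \<psi>] that by (simp add: dictionary_unit[OF assms])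
    ultimately show "x \<le> 1"
      by auto
  qed
  then show "0 \<le> coherence D"
    and "\<phi> \<in> D \<Longrightarrow> \<psi> \<in> D \<Longrightarrow> \<phi> \<noteq> \<psi> \<Longrightarrow> \<bar>\<phi> \<bullet> \<psi>\<bar> \<le> coherence D"
    unfolding coherence_def by (auto intro!: cSup_upper)
qed

lemma OGA_projection:
  assumes "OGA_realization D f g G r"
  shows "is_orthogonal_projection (span (g ` {1..n})) f (G n)" and "r n = f - G n"
proof -
  have "is_orthogonal_projection (span (g ` {1..n})) f (G n) \<and> r n = f - G n"
  proof (cases n)
    case 0
    then show ?thesis
      using assms by (simp add: OGA_realization_def is_orthogonal_projection_def orthogonal_def)
  next
    case (Suc k)
    then show ?thesis
      using assms by (simp only: OGA_realization_def)
  qed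
  then show "is_orthogonal_projection (span (g ` {1..n})) f (G n)" and "r n = f - G n"
    by auto
qed

lemma OGA_selected_in:
  assumes "OGA_realization D f g G r"
  shows "g ` {1..n} \<subseteq> D"
proof -
  have "g i \<in> D" if "1 \<le> i" for i
    using assms that by (cases i) (auto simp: OGA_realization_def)
  then show ?thesis by auto
qed

lemma OGA_greedy:
  fixes D :: "'a::real_inner set"
  assumes "dictionary D" and "OGA_realization D f g G r" and "t \<in> D"
  shows "\<bar>r n \<bullet> t\<bar> \<le> \<bar>r n \<bullet> g (Suc n)\<bar>"
proof -
  have "bdd_above ((\<lambda>h. \<bar>r n \<bullet> h\<bar>) ` D)"
  proof (rule bdd_aboveI2)
    fix h assume "h \<in> D"
    then show "\<bar>r n \<bullet> h\<bar> \<le> norm (r n)"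
      using Cauchy_Schwarz_ineq2[of "r n" h] dictionary_unit[OF assms(1)] by simp
  qed
  then have "\<bar>r n \<bullet> t\<bar> \<le> (SUP h\<in>D. \<bar>r n \<bullet> h\<bar>)"
    using assms(3) by (rule cSUP_upper2) simp
  with assms(2) show ?thesis
    by (simp add: OGA_realization_def)
qed

lemma OGA_norm_residual_antimono:
  assumes "OGA_realization D f g G r" and "n \<le> k"
  shows "norm (r k) \<le> norm (r n)"
proof -
  have "g ` {1..n} \<subseteq> g ` {1..k}"
    using assms(2) by (intro image_mono) simp
  with OGA_projection(1)[OF assms(1), of n] OGA_projection(1)[OF assms(1), of k]
  have "norm (f - G k) \<le> norm (f - G n)"
    by (rule norm_residual_antimono)
  then show ?thesis
    by (simp only: OGA_projection(2)[OF assms(1)])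
qed

section \<open>Comparison with a fixed set of atoms\<close>

lemma OGA_residual_le_dist_span:
  fixes D T :: "'a::real_inner set"
  assumes D: "dictionary D" and oga: "OGA_realization D f g G r"
    and T: "T \<subseteq> D" "finite T" "card T \<le> m" and "1 \<le> m"
    and small: "real m * coherence D \<le> 1 / 20"
    and y: "y \<in> span T"
  shows "norm (r (2 * m)) \<le> 3 * norm (f - y)"
proof -
  define \<mu> where "\<mu> = coherence D"
  define A where "A n = g ` {1..n}" for n
  define P where "P n = (SOME p. is_orthogonal_projection (span (A n \<union> T)) f p)" for n
  define E where "E n = (norm (f - P n))\<^sup>2" for n
  define d where "d n = \<bar>r n \<bullet> g (Suc n)\<bar>" for n
  define W where "W = {n \<in> {..<2 * m}. g (Suc n) \<notin> T - A n}"
  have \<mu>0: "0 \<le> \<mu>"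
    using D by (simp add: \<mu>_def coherence_nonneg)
  have finA: "finite (A n)" and AD: "A n \<subseteq> D" for n
    using OGA_selected_in[OF oga] by (auto simp: A_def)
  have A_mono: "A n \<subseteq> A (Suc n)" and gA: "g (Suc n) \<in> A (Suc n)" for n
    by (auto simp: A_def)
  have gD: "g (Suc n) \<in> D" for n
    using AD gA by blast
  have unit: "norm s = 1" if "s \<in> A n \<union> T" for s n
    using that AD[of n] T(1) by (intro dictionary_unit[OF D]) auto
  have coh: "\<bar>s \<bullet> t\<bar> \<le> \<mu>" if "s \<in> A n \<union> T" "t \<in> D" "s \<noteq> t" for s t n
    unfolding \<mu>_def using that AD[of n] T(1) by (intro abs_inner_le_coherence[OF D]) auto
  have proj: "is_orthogonal_projection (span (A n \<union> T)) f (P n)" for n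
    unfolding P_def by (rule someI_ex, rule orthogonal_projection_span_exists) (use finA T in auto)
  have projA: "is_orthogonal_projection (span (A n)) f (G n)" for n
    unfolding A_def by (rule OGA_projection(1)[OF oga])
  have greedy: "\<bar>r n \<bullet> t\<bar> \<le> d n" if "t \<in> D" for t n
    unfolding d_def by (rule OGA_greedy[OF D oga that])
  have T_small: "card T * \<mu> \<le> 1 / 20"
    using mult_right_mono[OF _ \<mu>0, of "card T" "real m"] T(3) small by (simp add: \<mu>_def)
  have AT_small: "card (A n \<union> T) * \<mu> \<le> 3 / 20" if "n \<le> 2 * m" for n
  proof -
    have "card (A n) \<le> n"
      unfolding A_def using card_image_le[of "{1..n}" g] by simp
    then have "card (A n \<union> T) \<le> 3 * m"
      using card_Un_le[of "A n" T] T(3) that by linarith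
    then have "card (A n \<union> T) * \<mu> \<le> real (3 * m) * \<mu>"
      using \<mu>0 by (intro mult_right_mono) auto
    then show ?thesis
      using small by (simp add: \<mu>_def)
  qed
  have E_decreasing: "E (Suc n) \<le> E n" for n
    unfolding E_def using A_mono
    by (intro power_mono norm_residual_antimono[OF proj proj]) auto
  have wrong_step: "(16 / 17 * d n)\<^sup>2 \<le> E n - E (Suc n)" if "n \<in> W" for n
  proof (cases "g (Suc n) \<in> A n")
    \<comment> \<open>An atom is selected again only if the greedy maximum is zero.\<close>
    case True
    then have "d n = 0"
      using projA[of n] span_base[OF True]
      by (simp add: d_def OGA_projection(2)[OF oga] is_orthogonal_projection_def orthogonal_def)
    then show ?thesis
      using E_decreasing[of n] by simp
  next
    case False
    with that have fresh: "g (Suc n) \<notin> A n \<union> T" and n: "n \<le> 2 * m"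
      by (auto simp: W_def)
    have "16 / 17 * d n \<le> \<bar>(f - P n) \<bullet> g (Suc n)\<bar>"
      unfolding d_def
    proof (rule fresh_atom_correlation[OF finA T(2) \<mu>0 unit _ projA _ proj])
      show "\<bar>s \<bullet> t\<bar> \<le> \<mu>" if "s \<in> A n \<union> T" "t \<in> A n \<union> T" "s \<noteq> t" for s t
        using that AD[of n] T(1) by (intro coh) auto
      show "\<bar>s \<bullet> g (Suc n)\<bar> \<le> \<mu>" if "s \<in> A n \<union> T" for s
        using that fresh gD by (intro coh) auto
      show "\<bar>r n \<bullet> t\<bar> \<le> \<bar>r n \<bullet> g (Suc n)\<bar>" if "t \<in> T" for t
        using that T(1) greedy by (auto simp: d_def)
    qed (use AT_small[OF n] T_small OGA_projection(2)[OF oga] in auto)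
    then have "(16 / 17 * d n)\<^sup>2 \<le> ((f - P n) \<bullet> g (Suc n))\<^sup>2"
      by (subst power2_abs[symmetric], intro power_mono) (auto simp: d_def)
    moreover have "E (Suc n) \<le> E n - ((f - P n) \<bullet> g (Suc n))\<^sup>2"
      unfolding E_def
      by (rule projection_insert_decrease[OF proj proj])
        (use A_mono gA dictionary_unit[OF D gD] in auto)
    ultimately show ?thesis
      by linarith
  qed
  have finW: "finite W"
    by (simp add: W_def)
  have "m \<le> card W"
  proof -
    \<comment> \<open>Each atom of \<open>T\<close> is new at most once, so the steps that are not wrong inject into \<open>T\<close>.\<close>
    let ?C = "{..<2 * m} - W"
    have later: "g (Suc i) \<noteq> g (Suc j)" if "i < j" "j \<in> ?C" for i j
    proof -
      have "g (Suc i) \<in> A j"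
        using that(1) by (auto simp: A_def)
      then show ?thesis
        using that(2) by (auto simp: W_def)
    qed
    have "inj_on (\<lambda>n. g (Suc n)) ?C"
    proof (rule inj_onI)
      fix i j assume "i \<in> ?C" "j \<in> ?C" "g (Suc i) = g (Suc j)"
      then show "i = j"
        using later[of i j] later[of j i] by (cases i j rule: linorder_cases) simp_all
    qed
    moreover have "(\<lambda>n. g (Suc n)) ` ?C \<subseteq> T"
      by (auto simp: W_def)
    ultimately have "card ?C \<le> card T"
      using T(2) by (rule card_inj_on_le)
    moreover have "card ?C = 2 * m - card W"
      using finW by (subst card_Diff_subset) (auto simp: W_def)
    ultimately show ?thesis
      using T(3) by linarith
  qed
  have energy: "(\<Sum>n\<in>W. (d n)\<^sup>2) \<le> (17 / 16)\<^sup>2 * E 0"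
  proof -
    have "(16 / 17)\<^sup>2 * (\<Sum>n\<in>W. (d n)\<^sup>2) = (\<Sum>n\<in>W. (16 / 17 * d n)\<^sup>2)"
      by (simp add: sum_distrib_left power_mult_distrib power_divide)
    also have "\<dots> \<le> (\<Sum>n\<in>W. E n - E (Suc n))"
      by (rule sum_mono) (rule wrong_step)
    also have "\<dots> \<le> (\<Sum>n<2 * m. E n - E (Suc n))"
      using E_decreasing by (intro sum_mono2) (auto simp: W_def)
    also have "\<dots> = E 0 - E (2 * m)"
      by (rule sum_lessThan_telescope')
    also have "\<dots> \<le> E 0"
      by (simp add: E_def)
    finally show ?thesis
      by (simp add: power2_eq_square)
  qed
  have each: "(norm (r (2 * m)))\<^sup>2 \<le> E 0 + 20 / 17 * m * (d n)\<^sup>2" if "n \<in> W" for n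
  proof -
    have n: "n \<le> 2 * m"
      using that by (simp add: W_def)
    have "(norm (r (2 * m)))\<^sup>2 \<le> (norm (r n))\<^sup>2"
      by (intro power_mono OGA_norm_residual_antimono[OF oga n]) simp
    also have "\<dots> \<le> E n + 20 / 17 * card T * (d n)\<^sup>2"
      unfolding E_def
    proof (rule residual_energy_bound[OF finA T(2) \<mu>0 unit _ projA _ proj])
      show "\<bar>s \<bullet> t\<bar> \<le> \<mu>" if "s \<in> A n \<union> T" "t \<in> A n \<union> T" "s \<noteq> t" for s t
        using that AD[of n] T(1) by (intro coh) auto
      show "\<bar>r n \<bullet> t\<bar> \<le> d n" if "t \<in> T" for t
        using that T(1) greedy by auto
    qed (use AT_small[OF n] OGA_projection(2)[OF oga] in \<open>auto simp: d_def\<close>)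
    also have "E n \<le> E 0"
      by (rule lift_Suc_antimono_le) (use E_decreasing in auto)
    also have "20 / 17 * card T * (d n)\<^sup>2 \<le> 20 / 17 * m * (d n)\<^sup>2"
      using T(3) by (intro mult_right_mono mult_left_mono) auto
    finally show ?thesis by simp
  qed
  define w where "w = real (card W)"
  have w: "real m \<le> w" "0 < w"
    using \<open>m \<le> card W\<close> \<open>1 \<le> m\<close> by (auto simp: w_def)
  have "w * (norm (r (2 * m)))\<^sup>2 \<le> (\<Sum>n\<in>W. E 0 + 20 / 17 * m * (d n)\<^sup>2)"
    unfolding w_def sum_constant[symmetric] by (rule sum_mono) (rule each)
  also have "\<dots> = w * E 0 + 20 / 17 * (m * (\<Sum>n\<in>W. (d n)\<^sup>2))"
    by (simp add: w_def sum.distrib sum_distrib_left mult.assoc)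
  also have "m * (\<Sum>n\<in>W. (d n)\<^sup>2) \<le> w * ((17 / 16)\<^sup>2 * E 0)"
    using energy w by (intro mult_mono sum_nonneg) auto
  also have "w * E 0 + 20 / 17 * (w * ((17 / 16)\<^sup>2 * E 0)) \<le> w * (9 * E 0)"
    using w(2) by (simp add: E_def power2_eq_square)
  finally have "(norm (r (2 * m)))\<^sup>2 \<le> 9 * E 0"
    using w(2) by simp
  also have "\<dots> = (3 * norm (f - P 0))\<^sup>2"
    by (simp add: E_def power_mult_distrib)
  finally have "norm (r (2 * m)) \<le> 3 * norm (f - P 0)"
    by (rule power2_le_imp_le) simp
  moreover have "norm (f - P 0) \<le> norm (f - y)"
    using proj[of 0] y by (intro orthogonal_projection_nearest) (auto simp: A_def)
  ultimately show ?thesis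
    by linarith
qed

theorem theorem1:
  fixes D :: "'a::{real_inner, complete_space} set"
    and f :: 'a
    and g G r :: "nat \<Rightarrow> 'a"
    and M :: real
    and m :: nat
  assumes "coherent_dictionary M D"
    and "OGA_realization D f g G r"
    and "1 \<le> m"
    and "M = 0 \<or> real m \<le> 1 / (20 * M)"
  shows "norm (f - G (2 * m)) = norm (r (2 * m)) \<and>
         norm (r (2 * m)) \<le> 3 * best_approx_error m D f"
proof
  show "norm (f - G (2 * m)) = norm (r (2 * m))"
    using OGA_projection(2)[OF assms(2)] by simp
next
  have D: "dictionary D" and M: "coherence D = M"
    using assms(1) by (auto simp: coherent_dictionary_def)
  have small: "real m * coherence D \<le> 1 / 20"
    using assms(4) coherence_nonneg[OF D] unfolding M
    by (cases "M = 0") (auto simp: field_simps)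
  let ?X = "{norm (f - (\<Sum>i = 1..m. c i *\<^sub>R \<phi> i)) | (c :: nat \<Rightarrow> real) \<phi>. \<forall>i\<in>{1..m}. \<phi> i \<in> D}"
  have "norm (r (2 * m)) / 3 \<le> Inf ?X"
  proof (rule cInf_greatest)
    have "norm (f - (\<Sum>i = 1..m. 0 *\<^sub>R g 1)) \<in> ?X"
      using OGA_selected_in[OF assms(2), of 1]
      by (intro CollectI exI[of _ "\<lambda>_. 0"] exI[of _ "\<lambda>_. g 1"]) auto
    then show "?X \<noteq> {}"
      by (metis empty_iff)
  next
    fix x assume "x \<in> ?X"
    then obtain c \<phi> where x: "x = norm (f - (\<Sum>i = 1..m. c i *\<^sub>R \<phi> i))"
      and \<phi>: "\<forall>i\<in>{1..m}. \<phi> i \<in> D"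
      by auto
    have "norm (r (2 * m)) \<le> 3 * norm (f - (\<Sum>i = 1..m. c i *\<^sub>R \<phi> i))"
    proof (rule OGA_residual_le_dist_span[OF D assms(2) _ _ _ assms(3) small])
      show "card (\<phi> ` {1..m}) \<le> m"
        using card_image_le[of "{1..m}" \<phi>] by simp
      show "(\<Sum>i = 1..m. c i *\<^sub>R \<phi> i) \<in> span (\<phi> ` {1..m})"
        by (intro span_sum span_scale span_base) auto
    qed (use \<phi> in auto)
    then show "norm (r (2 * m)) / 3 \<le> x"
      by (simp add: x)
  qed
  then show "norm (r (2 * m)) \<le> 3 * best_approx_error m D f"
    by (simp add: best_approx_error_def)
qed

end
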